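(* Let $m\in\mathbb{N}$ with $m\geq2$. For every $\beta\in(2^{1/m},2)$, $$\limsup_{k\to\infty}\frac{\log_2\mathcal{N}_k(x,\beta)}{k}\leq\frac{\log_2(2^m-1)}{m}\quad\text{for all }x\in\Big(0,\frac{1}{\beta-1}\Big).$$
   Context: For $1<\beta<2$, $x\in[0,\frac{1}{\beta-1}]$ and $k\in\mathbb{N}$, let $\mathcal{E}_k(x,\beta)$ be the set of $(\epsilon_1,\ldots,\epsilon_k)\in\{0,1\}^k$ for which there exists $(\epsilon_{k+1},\epsilon_{k+2},\ldots)\in\{0,1\}^{\mathbb{N}}$ with $\sum_{n=1}^{\infty}\epsilon_n\beta^{-n}=x$, and let $\mathcal{N}_k(x,\beta)=\#\mathcal{E}_k(x,\beta)$. *)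

theory Defs
  imports "HOL-Library.Extended_Real" "HOL-Library.Liminf_Limsup" Complex_Main
begin

(* Digit sequences carry the index of the expansion, epsilon 1, epsilon 2, ...; the value
   epsilon 0 is never used.  A word (epsilon 1, ..., epsilon k) is encoded as a list of length k,
   so its entry number i (counted from 0) is epsilon (Suc i). *)

definition is_expansion :: "real \<Rightarrow> real \<Rightarrow> (nat \<Rightarrow> nat) \<Rightarrow> bool" where
  "is_expansion \<beta> x \<epsilon> \<longleftrightarrow>
     (\<forall>n\<ge>1. \<epsilon> n \<in> {0, 1}) \<and> (\<lambda>n. real (\<epsilon> (Suc n)) / \<beta> ^ Suc n) sums x"

definition prefix_set :: "nat \<Rightarrow> real \<Rightarrow> real \<Rightarrow> nat list set" where
  "prefix_set k x \<beta> =
     {w. length w = k \<and> set w \<subseteq> {0, 1} \<and>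
         (\<exists>\<epsilon>. (\<forall>i<k. \<epsilon> (Suc i) = w ! i) \<and> is_expansion \<beta> x \<epsilon>)}"

definition prefix_count :: "nat \<Rightarrow> real \<Rightarrow> real \<Rightarrow> nat" where
  "prefix_count k x \<beta> = card (prefix_set k x \<beta>)"

end

theory Submission
  imports Defs
begin

text \<open>
  The idea is a pigeonhole at scale \<open>m\<close>. Every number that has an expansion in base \<open>\<beta>\<close> lies in
  the interval from \<open>0\<close> to \<open>1 / (\<beta> - 1)\<close>. If \<open>x\<close> had an expansion that begins with \<open>0 ... 0\<close>
  (\<open>m\<close> digits), it would satisfy \<open>(\<beta> - 1) * x \<le> \<beta> ^ (-m)\<close>; if it had one that begins with
  \<open>1 ... 1\<close>, it would satisfy \<open>(\<beta> - 1) * x \<ge> 1 - \<beta> ^ (-m)\<close>. Both together force \<open>\<beta> ^ m \<le> 2\<close>. So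
  when \<open>\<beta> > 2 powr (1 / m)\<close>, every real number misses at least one of the \<open>2 ^ m\<close> words of
  length \<open>m\<close> (\<open>prefix_count_block\<close>).

  This bound is uniform in \<open>x\<close>, hence it can be iterated: deleting a prefix \<open>u\<close> from an expansion of
  \<open>x\<close> leaves an expansion of a number \<open>tail_value \<beta> x u\<close> that depends only on \<open>x\<close> and \<open>u\<close>, so
  uniform bounds on prefix counts are submultiplicative in the length (\<open>prefix_count_add_le\<close>).
  Cutting a word of length \<open>k\<close> into \<open>k div m\<close> blocks of length \<open>m\<close> and a short rest gives at most
  \<open>2 ^ m * (2 ^ m - 1) ^ (k div m)\<close> prefixes, and the bounded factor disappears in the limit.
\<close>

text \<open>
  This is the image of \<open>x\<close> under the composition of the maps \<open>y \<mapsto> \<beta> * y - d\<close>, where \<open>d\<close> runs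
  through the digits of \<open>u\<close> from first to last.
\<close>

definition tail_value :: "real \<Rightarrow> real \<Rightarrow> nat list \<Rightarrow> real" where
  "tail_value \<beta> x u = \<beta> ^ length u * (x - (\<Sum>i<length u. real (u ! i) / \<beta> ^ Suc i))"

lemma is_expansion_tail:
  assumes "\<beta> > 0" and exp: "is_expansion \<beta> x \<epsilon>" and u: "\<forall>i<length u. \<epsilon> (Suc i) = u ! i"
  shows "is_expansion \<beta> (tail_value \<beta> x u) (\<lambda>n. \<epsilon> (n + length u))"
proof -
  let ?k = "length u"
  let ?f = "\<lambda>n. real (\<epsilon> (Suc n)) / \<beta> ^ Suc n"
  have "?f sums x"
    using exp by (simp add: is_expansion_def)
  then have "(\<lambda>n. ?f (n + ?k)) sums (x - (\<Sum>i<?k. ?f i))"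
    by (rule sums_split_initial_segment)
  moreover have "(\<Sum>i<?k. ?f i) = (\<Sum>i<?k. real (u ! i) / \<beta> ^ Suc i)"
    using u by (intro sum.cong) auto
  ultimately have "(\<lambda>n. \<beta> ^ ?k * ?f (n + ?k)) sums tail_value \<beta> x u"
    unfolding tail_value_def by (simp only: sums_mult)
  moreover have "\<beta> ^ ?k * ?f (n + ?k) = real (\<epsilon> (Suc n + ?k)) / \<beta> ^ Suc n" for n
    using \<open>\<beta> > 0\<close> by (simp add: power_add field_simps)
  ultimately show ?thesis
    using exp by (simp add: is_expansion_def)
qed

lemma is_expansion_bounds:
  assumes "\<beta> > 1" and exp: "is_expansion \<beta> x \<epsilon>"
  shows "0 \<le> x" and "x \<le> 1 / (\<beta> - 1)"
proof -
  let ?f = "\<lambda>n. real (\<epsilon> (Suc n)) / \<beta> ^ Suc n"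
  have f: "?f sums x" and digit: "real (\<epsilon> (Suc n)) \<le> 1" for n
    using exp by (auto simp: is_expansion_def le_Suc_eq dest: spec[of _ "Suc n"])
  show "0 \<le> x"
    using \<open>\<beta> > 1\<close> by (intro sums_le[OF _ sums_zero f]) simp
  have "(\<lambda>n. (1 / \<beta>) * (1 / \<beta>) ^ n) sums ((1 / \<beta>) * (1 / (1 - 1 / \<beta>)))"
    using \<open>\<beta> > 1\<close> by (intro sums_mult geometric_sums) simp
  moreover have "(1 / \<beta>) * (1 / (1 - 1 / \<beta>)) = 1 / (\<beta> - 1)"
    using \<open>\<beta> > 1\<close> by (simp add: field_simps)
  ultimately have geometric: "(\<lambda>n. (1 / \<beta>) * (1 / \<beta>) ^ n) sums (1 / (\<beta> - 1))"
    by simp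
  show "x \<le> 1 / (\<beta> - 1)"
  proof (rule sums_le[OF _ f geometric])
    show "?f n \<le> (1 / \<beta>) * (1 / \<beta>) ^ n" for n
      using digit[of n] \<open>\<beta> > 1\<close> by (simp add: power_one_over divide_simps)
  qed
qed

lemma prefix_set_subset_words: "prefix_set k x \<beta> \<subseteq> {w. set w \<subseteq> {0, 1} \<and> length w = k}"
  by (auto simp: prefix_set_def)

lemma card_binary_words: "card {w :: nat list. set w \<subseteq> {0, 1} \<and> length w = k} = 2 ^ k"
  by (subst card_lists_length_eq) (simp_all add: numeral_2_eq_2)

lemma finite_binary_words: "finite {w :: nat list. set w \<subseteq> {0, 1} \<and> length w = k}"
  by (rule finite_lists_length_eq) simp

lemma finite_prefix_set: "finite (prefix_set k x \<beta>)"
  using finite_subset[OF prefix_set_subset_words finite_binary_words] .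

lemma prefix_count_le: "prefix_count k x \<beta> \<le> 2 ^ k"
  unfolding prefix_count_def card_binary_words[symmetric]
  by (rule card_mono[OF finite_binary_words prefix_set_subset_words])

lemma tail_value_bounds:
  assumes "\<beta> > 1" and "w \<in> prefix_set k x \<beta>"
  shows "0 \<le> tail_value \<beta> x w" and "tail_value \<beta> x w \<le> 1 / (\<beta> - 1)"
  using is_expansion_bounds[OF \<open>\<beta> > 1\<close> is_expansion_tail] assms
  by (fastforce simp: prefix_set_def)+

text \<open>
  The point is that the tail after a prefix \<open>u\<close> is an expansion of a number determined by \<open>u\<close>
  alone. For each \<open>u\<close> the number of continuations is then itself a prefix count, to which the bound
  that is uniform in the starting point applies.
\<close>

lemma prefix_count_add_le:
  assumes "\<beta> > 0" and A: "prefix_count a x \<beta> \<le> A" and B: "\<And>y. prefix_count b y \<beta> \<le> B"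
  shows "prefix_count (a + b) x \<beta> \<le> A * B"
proof -
  let ?U = "\<Union>u \<in> prefix_set a x \<beta>. (@) u ` prefix_set b (tail_value \<beta> x u) \<beta>"
  have sub: "prefix_set (a + b) x \<beta> \<subseteq> ?U"
  proof
    fix w assume "w \<in> prefix_set (a + b) x \<beta>"
    then obtain \<epsilon> where len: "length w = a + b" and set: "set w \<subseteq> {0, 1}"
      and dig: "\<forall>i<a + b. \<epsilon> (Suc i) = w ! i" and exp: "is_expansion \<beta> x \<epsilon>"
      by (auto simp: prefix_set_def)
    define u v where "u = take a w" and "v = drop a w"
    have uv: "length u = a" "length v = b" "set u \<subseteq> {0, 1}" "set v \<subseteq> {0, 1}" "w = u @ v"
      using len set set_take_subset[of a w] set_drop_subset[of a w] by (auto simp: u_def v_def)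
    have dig_u: "\<forall>i<length u. \<epsilon> (Suc i) = u ! i"
      using dig uv by (simp add: nth_append)
    have "\<forall>i<b. \<epsilon> (Suc i + a) = v ! i"
    proof (intro allI impI)
      fix i assume "i < b"
      then have "\<epsilon> (Suc (a + i)) = w ! (a + i)"
        using dig by simp
      then show "\<epsilon> (Suc i + a) = v ! i"
        using uv by (simp add: nth_append add.commute)
    qed
    moreover have "is_expansion \<beta> (tail_value \<beta> x u) (\<lambda>n. \<epsilon> (n + a))"
      using is_expansion_tail[OF \<open>\<beta> > 0\<close> exp dig_u] uv by simp
    ultimately have "v \<in> prefix_set b (tail_value \<beta> x u) \<beta>"
      using uv by (auto simp: prefix_set_def intro!: exI[of _ "\<lambda>n. \<epsilon> (n + a)"])
    moreover have "u \<in> prefix_set a x \<beta>"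
      using uv dig_u exp unfolding prefix_set_def by blast
    ultimately show "w \<in> ?U"
      using uv by blast
  qed
  have "prefix_count (a + b) x \<beta> \<le> card ?U"
    unfolding prefix_count_def by (intro card_mono sub) (simp add: finite_prefix_set)
  also have "\<dots> \<le> (\<Sum>u \<in> prefix_set a x \<beta>. card ((@) u ` prefix_set b (tail_value \<beta> x u) \<beta>))"
    by (rule card_UN_le[OF finite_prefix_set])
  also have "\<dots> \<le> (\<Sum>u \<in> prefix_set a x \<beta>. B)"
    using B by (intro sum_mono) (auto simp: prefix_count_def card_image inj_on_def)
  also have "\<dots> = prefix_count a x \<beta> * B"
    by (simp add: prefix_count_def)
  also have "\<dots> \<le> A * B"
    using A by simp
  finally show ?thesis .
qed

lemma geometric_block_sum:
  assumes "\<beta> > (1::real)"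
  shows "(\<beta> - 1) * (\<Sum>i<m. 1 / \<beta> ^ Suc i) = 1 - 1 / \<beta> ^ m"
  using assms by (induction m) (simp_all add: field_simps)

text \<open>
  The tails after \<open>0 ... 0\<close> and \<open>1 ... 1\<close> would differ by \<open>(\<beta> ^ m - 1) / (\<beta> - 1)\<close>, which for
  \<open>\<beta> ^ m > 2\<close> exceeds the length of the interval in which both of them must lie.
\<close>

lemma prefix_count_block:
  assumes "\<beta> > 1" and "\<beta> ^ m > 2"
  shows "prefix_count m x \<beta> \<le> 2 ^ m - 1"
proof -
  let ?W = "{w :: nat list. set w \<subseteq> {0, 1} \<and> length w = m}"
  have "\<not> (replicate m 0 \<in> prefix_set m x \<beta> \<and> replicate m 1 \<in> prefix_set m x \<beta>)"
  proof
    assume both: "replicate m 0 \<in> prefix_set m x \<beta> \<and> replicate m 1 \<in> prefix_set m x \<beta>"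
    have "\<beta> ^ m * x \<le> 1 / (\<beta> - 1)"
      using tail_value_bounds(2)[OF \<open>\<beta> > 1\<close> conjunct1[OF both]] by (simp add: tail_value_def)
    then have zeros: "\<beta> ^ m * ((\<beta> - 1) * x) \<le> 1"
      using \<open>\<beta> > 1\<close> by (simp add: pos_le_divide_eq algebra_simps)
    have "0 \<le> \<beta> ^ m * (x - (\<Sum>i<m. 1 / \<beta> ^ Suc i))"
      using tail_value_bounds(1)[OF \<open>\<beta> > 1\<close> conjunct2[OF both]] by (simp add: tail_value_def)
    moreover have "\<beta> ^ m > 0"
      using \<open>\<beta> > 1\<close> by simp
    ultimately have "(\<Sum>i<m. 1 / \<beta> ^ Suc i) \<le> x"
      by (simp only: zero_le_mult_iff) linarith
    then have "(\<beta> - 1) * (\<Sum>i<m. 1 / \<beta> ^ Suc i) \<le> (\<beta> - 1) * x"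
      using \<open>\<beta> > 1\<close> by (intro mult_left_mono) auto
    then have "1 - 1 / \<beta> ^ m \<le> (\<beta> - 1) * x"
      by (simp only: geometric_block_sum[OF \<open>\<beta> > 1\<close>])
    then have "\<beta> ^ m * (1 - 1 / \<beta> ^ m) \<le> \<beta> ^ m * ((\<beta> - 1) * x)"
      using \<open>\<beta> > 1\<close> by (intro mult_left_mono) auto
    then have "\<beta> ^ m - 1 \<le> \<beta> ^ m * ((\<beta> - 1) * x)"
      using \<open>\<beta> > 1\<close> by (simp add: right_diff_distrib)
    with zeros \<open>\<beta> ^ m > 2\<close> show False
      by linarith
  qed
  moreover have "replicate m 0 \<in> ?W" "replicate m 1 \<in> ?W"
    by auto
  ultimately have "prefix_set m x \<beta> \<subset> ?W"
    using prefix_set_subset_words[of m x \<beta>] by blast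
  then have "prefix_count m x \<beta> < 2 ^ m"
    using psubset_card_mono[OF finite_binary_words] by (metis prefix_count_def card_binary_words)
  then show ?thesis
    by simp
qed

lemma prefix_count_blocks:
  assumes "\<beta> > 1" and "\<beta> ^ m > 2"
  shows "prefix_count (m * j) x \<beta> \<le> (2 ^ m - 1) ^ j"
proof (induction j arbitrary: x)
  case 0
  show ?case
    using prefix_count_le[of 0 x \<beta>] by simp
next
  case (Suc j)
  show ?case
    using prefix_count_add_le[OF _ prefix_count_block[OF assms] Suc.IH] \<open>\<beta> > 1\<close> by simp
qed

lemma log_prefix_count_le:
  assumes "\<beta> > 1" and "\<beta> ^ m > 2" and "m \<ge> 1"
  shows "log 2 (real (prefix_count k x \<beta>)) \<le> real m + real k * (log 2 (2 ^ m - 1) / real m)"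
proof -
  define M where "M = (2 ^ m - 1 :: nat)"
  have "(2::nat) ^ 1 \<le> 2 ^ m"
    using \<open>m \<ge> 1\<close> by (intro power_increasing) auto
  then have M: "M \<ge> 1" "real M = 2 ^ m - 1"
    by (auto simp: M_def of_nat_diff)
  then have L: "log 2 (real M) \<ge> 0"
    by simp
  show ?thesis
  proof (cases "prefix_count k x \<beta> = 0")
    case True
    \<comment> \<open>The value \<open>log 2 0 = 0\<close> is harmless, since the bound is nonnegative.\<close>
    then show ?thesis
      using L M by (simp add: log_def)
  next
    case False
    have "prefix_count (k mod m + m * (k div m)) x \<beta> \<le> 2 ^ (k mod m) * M ^ (k div m)"
      unfolding M_def using assms
      by (intro prefix_count_add_le prefix_count_le prefix_count_blocks) auto
    then have "prefix_count k x \<beta> \<le> 2 ^ (k mod m) * M ^ (k div m)"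
      by simp
    then have "real (prefix_count k x \<beta>) \<le> real (2 ^ (k mod m) * M ^ (k div m))"
      by (rule of_nat_mono)
    then have "log 2 (real (prefix_count k x \<beta>)) \<le> log 2 (real (2 ^ (k mod m) * M ^ (k div m)))"
      using False by (intro log_mono) auto
    also have "\<dots> = real (k mod m) + real (k div m) * log 2 (real M)"
      using M(1) by (simp add: log_mult log_nat_power)
    also have "\<dots> \<le> real m + real k / real m * log 2 (real M)"
      using \<open>m \<ge> 1\<close> L of_nat_div_le_of_nat[of k m]
      by (intro add_mono mult_right_mono of_nat_mono) auto
    finally show ?thesis
      by (simp add: M(2))
  qed
qed

theorem theorem4p2:
  fixes m :: nat and \<beta> x :: real
  assumes "m \<ge> 2"
    and "\<beta> \<in> {2 powr (1 / real m)<..<2}"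
    and "x \<in> {0<..<1 / (\<beta> - 1)}"
  shows "limsup (\<lambda>k. ereal (log 2 (real (prefix_count k x \<beta>)) / real k))
           \<le> ereal (log 2 (2 ^ m - 1) / real m)"
proof -
  let ?R = "log 2 (2 ^ m - 1) / real m"
  have root: "2 powr (1 / real m) < \<beta>"
    using assms by simp
  have "(1::real) < 2 powr (1 / real m)"
    using \<open>m \<ge> 2\<close> by simp
  with root have "\<beta> > 1"
    by linarith
  have "(2 powr (1 / real m)) ^ m < \<beta> ^ m"
    using root \<open>m \<ge> 2\<close> by (intro power_strict_mono) auto
  then have "\<beta> ^ m > 2"
    using \<open>m \<ge> 2\<close> by (simp add: powr_power)
  have bound: "log 2 (real (prefix_count k x \<beta>)) / real k \<le> real m / real k + ?R" if "k \<ge> 1" for k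
  proof -
    have "log 2 (real (prefix_count k x \<beta>)) / real k \<le> (real m + real k * ?R) / real k"
      using log_prefix_count_le[OF \<open>\<beta> > 1\<close> \<open>\<beta> ^ m > 2\<close>] \<open>m \<ge> 2\<close>
      by (intro divide_right_mono) auto
    then show ?thesis
      using that by (simp add: add_divide_distrib)
  qed
  have "limsup (\<lambda>k. ereal (log 2 (real (prefix_count k x \<beta>)) / real k))
          \<le> limsup (\<lambda>k. ereal (real m / real k + ?R))"
    using bound by (intro Limsup_mono eventually_sequentiallyI[of 1]) simp
  also have "(\<lambda>k. real m / real k + ?R) \<longlonglongrightarrow> 0 + ?R"
    by (intro tendsto_intros lim_const_over_n)
  then have "limsup (\<lambda>k. ereal (real m / real k + ?R)) = ereal ?R"
    by (intro lim_imp_Limsup) simp_all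
  finally show ?thesis .
qed

end
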